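(* Let $H_k=\int_0^1\left(\frac{g(x)}{\pi}\right)^{2k}dx$ for $k\in\mathbb{N}\cup\{0\}$. Then the power series $$\sum_{k\ge 0}\frac{H_k}{(2k)!}x^k$$ diverges for every $x\in\mathbb{C}$ with $|x|>\pi^2$.
   Context: For real $u$, $\{u\}$ denotes the fractional part of $u$. The function $g$ is defined by $$g(x)=\sum_{l\ge 1}\frac{1-2\{lx\}}{l},$$ wherever this series converges (it converges for almost every $x\in[0,1]$). *)

theory Defs
  imports "HOL-Analysis.Analysis"
begin

text \<open>The series runs over \<open>l \<ge> 1\<close>, so its index is shifted by \<open>Suc\<close>. It converges almost
  everywhere; the value 0 of \<open>g\<close> where it diverges is a convention that does not affect \<open>H\<close>.\<close>

definition g_term :: "real \<Rightarrow> nat \<Rightarrow> real" where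
  "g_term x l = (1 - 2 * frac (real (Suc l) * x)) / real (Suc l)"

definition g :: "real \<Rightarrow> real" where
  "g x = (if summable (g_term x) then (\<Sum>l. g_term x l) else 0)"

definition H :: "nat \<Rightarrow> real" where
  "H k = (LINT x:{0..1}|lebesgue. (g x / pi) ^ (2 * k))"

end

theory Submission
  imports Defs
begin

text \<open>
  Write \<open>S N\<close> for the partial sums of the series. By the distribution relation of the sawtooth,
  \<open>saw (l x)\<close> and \<open>saw (m x)\<close> have correlation at most \<open>gcd(l,m)\<^sup>2 / (l m)\<close>, so that
  \<open>\<integral> (S N - S M)\<^sup>2 \<le> 12 / M\<close>. Along \<open>N = j ^ 4\<close> this gives almost everywhere convergence, along
  \<open>N = 4 ^ j\<close> finiteness of all moments, and in the limit \<open>\<integral> (g - S n)\<^sup>2 \<le> 12 / n\<close>.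
  On \<open>[0, 1/n)\<close> one has \<open>S n \<ge> ln n - 2\<close>, and the last bound shows that the mean of \<open>g\<close> over this
  interval is at least \<open>ln n - 9\<close>. By convexity \<open>\<integral> g ^ p \<ge> (ln n - 9) ^ p / n\<close>; taking \<open>ln n\<close> close to
  \<open>p + 9\<close> yields \<open>\<integral> g ^ p \<ge> c p! / p\<close> with an absolute constant \<open>c > 0\<close>, so the terms of the power
  series are unbounded for \<open>\<bar>x\<bar> > \<pi>\<^sup>2\<close>.
\<close>

section \<open>Correlations of dilated sawtooth functions\<close>

text \<open>Half-open, so that it is exactly the disjoint union of the pieces from
  \<open>j / n\<close> to \<open>(j + 1) / n\<close>. Passing to the closed interval and the
  completed measure in \<open>H\<close> changes no integral.\<close>

abbreviation unit_interval :: "real measure" where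
  "unit_interval \<equiv> restrict_space lborel {0..<1}"

interpretation unit_interval: finite_measure unit_interval
  by (rule finite_measureI) (simp add: emeasure_restrict_space)

lemma integral_unit_interval:
  "integral\<^sup>L unit_interval f = (\<integral>x. indicator {0..<1} x * f x \<partial>lborel)" for f :: "real \<Rightarrow> real"
  by (subst integral_restrict_space) auto

lemma integrable_unit_interval:
  "integrable unit_interval f \<longleftrightarrow> integrable lborel (\<lambda>x. indicator {0..<1} x * f x)" for f :: "real \<Rightarrow> real"
  by (subst integrable_restrict_space) auto

lemma measurable_unit_interval:
  "f \<in> borel_measurable borel \<Longrightarrow> f \<in> borel_measurable unit_interval"
  by (simp add: measurable_restrict_space1)

lemma measure_unit_interval: "measure unit_interval {0..<1} = 1"
  by (simp add: measure_restrict_space)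

lemma integrable_bounded_unit_interval:
  fixes f :: "real \<Rightarrow> real"
  assumes "f \<in> borel_measurable borel" "\<And>x. \<bar>f x\<bar> \<le> B"
  shows "integrable unit_interval f"
  using assms by (intro unit_interval.integrable_const_bound[of _ B]) (auto simp: measurable_unit_interval)

text \<open>Cut the interval into \<open>n\<close> equal pieces and rescale each to full length.
  With \<open>n = m\<close>, a factor \<open>saw (m x)\<close> becomes the same function of
  \<open>u\<close> on every piece.\<close>

lemma integral_unit_interval_split:
  fixes f :: "real \<Rightarrow> real"
  assumes "integrable unit_interval f" and n: "n > 0"
  shows "integral\<^sup>L unit_interval f
       = integral\<^sup>L unit_interval (\<lambda>u. \<Sum>j<n. f ((u + real j) / real n)) / real n"
proof -
  define I where "I j = {real j / n ..< real (Suc j) / n}" for j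
  have ind: "indicator {0..<1} x = (\<Sum>j<n. indicator (I j) x :: real)" for x
  proof -
    \<comment> \<open>The index of the piece is the floor of \<open>x * n\<close>, so at most one
      indicator is nonzero. The conjunct on the sign of \<open>x\<close> is kept because
      \<open>nat\<close> sends negative floors to 0.\<close>
    have *: "x \<in> I j \<longleftrightarrow> 0 \<le> x \<and> nat \<lfloor>x * n\<rfloor> = j" for j
    proof -
      have "x \<in> I j \<longleftrightarrow> real j \<le> x * n \<and> x * n < real j + 1"
        using n by (auto simp: I_def field_simps)
      also have "\<dots> \<longleftrightarrow> \<lfloor>x * n\<rfloor> = int j" by (simp add: floor_eq_iff)
      also have "\<dots> \<longleftrightarrow> 0 \<le> x \<and> nat \<lfloor>x * n\<rfloor> = j"
      proof (cases "0 \<le> x")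
        case True
        then show ?thesis by auto
      next
        case False
        then have "x * n < 0" using n by (simp add: mult_neg_pos)
        then have "\<lfloor>x * n\<rfloor> < 0" by simp
        then show ?thesis using False by linarith
      qed
      finally show ?thesis .
    qed
    have "(\<Sum>j<n. indicator (I j) x) = (\<Sum>j<n. if j = nat \<lfloor>x * n\<rfloor> then (if 0 \<le> x then 1 else 0) else (0::real))"
      by (intro sum.cong) (auto simp: indicator_def *)
    also have "\<dots> = (if 0 \<le> x \<and> nat \<lfloor>x * n\<rfloor> < n then 1 else 0)" by simp
    also have "0 \<le> x \<and> nat \<lfloor>x * n\<rfloor> < n \<longleftrightarrow> 0 \<le> x \<and> x < 1"
    proof -
      have "nat \<lfloor>x * n\<rfloor> < n \<longleftrightarrow> \<lfloor>x * n\<rfloor> < int n" using n by linarith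
      also have "\<dots> \<longleftrightarrow> x * n < n" by (simp add: floor_less_iff)
      also have "\<dots> \<longleftrightarrow> x < 1" using n by simp
      finally show ?thesis by simp
    qed
    finally show ?thesis by (simp add: indicator_def)
  qed
  have sub: "I j \<subseteq> {0..<1}" if "j < n" for j
  proof
    fix x assume "x \<in> I j"
    then have "real j / n \<le> x" "x < real (Suc j) / n" by (auto simp: I_def)
    moreover have "real (Suc j) / n \<le> 1" using that n by simp
    moreover have "0 \<le> real j / n" by simp
    ultimately show "x \<in> {0..<1}" by (simp only: atLeastLessThan_iff) linarith
  qed
  have int: "integrable lborel (\<lambda>x. indicator (I j) x * f x)" if "j < n" for j
  proof -
    have "integrable lborel (\<lambda>x. indicator (I j) x * (indicator {0..<1} x * f x))"
      using assms(1) integrable_mult_indicator[of "I j" lborel "\<lambda>x. indicator {0..<1} x * f x"]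
      by (simp add: integrable_unit_interval I_def)
    also have "(\<lambda>x. indicator (I j) x * (indicator {0..<1} x * f x)) = (\<lambda>x. indicator (I j) x * f x)"
      using sub[OF that] by (auto simp: indicator_def fun_eq_iff subset_iff)
    finally show ?thesis .
  qed
  have ind_aff: "indicator (I j) (real j / n + 1 / n * u) = (indicator {0..<1} u :: real)" for j u
    using n by (auto simp: I_def indicator_def field_simps)
  have aff: "real j / n + 1 / n * u = (u + j) / n" for j u
    using n by (simp add: field_simps)
  have int': "integrable unit_interval (\<lambda>u. f ((u + real j) / real n))" if "j < n" for j
    using lborel_integrable_real_affine[OF int[OF that], of "1 / n" "j / n"] n
    unfolding ind_aff unfolding aff by (simp add: integrable_unit_interval)
  have "integral\<^sup>L unit_interval f = (\<Sum>j<n. \<integral>x. indicator (I j) x * f x \<partial>lborel)"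
    unfolding integral_unit_interval ind sum_distrib_right by (intro Bochner_Integration.integral_sum int) auto
  also have "\<dots> = (\<Sum>j<n. 1 / n * integral\<^sup>L unit_interval (\<lambda>u. f ((u + real j) / real n)))"
  proof (intro sum.cong refl)
    fix j
    show "(\<integral>x. indicator (I j) x * f x \<partial>lborel) = 1 / n * integral\<^sup>L unit_interval (\<lambda>u. f ((u + real j) / real n))"
      using lborel_integral_real_affine[of "1 / n" "\<lambda>x. indicator (I j) x * f x" "j / n"] n
      unfolding ind_aff unfolding aff by (simp add: integral_unit_interval)
  qed
  also have "\<dots> = integral\<^sup>L unit_interval (\<lambda>u. \<Sum>j<n. f ((u + real j) / real n)) / real n"
    by (subst Bochner_Integration.integral_sum) (auto intro: int' simp: sum_divide_distrib)
  finally show ?thesis .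
qed

text \<open>This is -2 times the first Bernoulli polynomial of the fractional part; at integers it
  takes the value 1, not the mean value 0.\<close>

definition saw :: "real \<Rightarrow> real" where
  "saw y = 1 - 2 * frac y"

lemma saw_measurable [measurable]: "saw \<in> borel_measurable borel"
  unfolding saw_def frac_def by measurable

lemma abs_saw_le: "\<bar>saw y\<bar> \<le> 1"
  using frac_lt_1[of y] frac_ge_0[of y] by (auto simp: saw_def abs_le_iff simp del: frac_ge_0)

lemma abs_saw_mult_le: "\<bar>saw x * saw y\<bar> \<le> 1"
  unfolding abs_mult by (intro mult_le_one abs_saw_le abs_ge_zero)

lemma frac_add_of_nat: "frac (x + real n) = frac x"
  by (simp add: frac_def)

lemma saw_add_of_nat: "saw (x + real n) = saw x"
  by (simp add: saw_def frac_add_of_nat)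

lemma saw_add_fraction:
  assumes "0 \<le> t" "t < 1" "m > 0"
  shows "saw ((t + real k) / real m) = 1 - 2 * (t + real (k mod m)) / real m"
proof -
  have "(t + real k) / real m = (t + real (k mod m)) / m + real (k div m)"
    using assms(3) by (simp add: field_simps flip: of_nat_mult of_nat_add)
  moreover have "frac ((t + real (k mod m)) / m) = (t + real (k mod m)) / m"
  proof (subst frac_eq, intro conjI)
    have "k mod m + 1 \<le> m" using assms by (simp add: Suc_leI)
    then have "real (k mod m) + 1 \<le> m" by (simp flip: of_nat_Suc)
    then have "t + real (k mod m) < m" using assms by linarith
    then show "(t + real (k mod m)) / m < 1" using assms by simp
  qed (use assms in auto)
  ultimately show ?thesis by (simp add: saw_def frac_add_of_nat)
qed

lemma bij_betw_mult_mod: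
  fixes l m :: nat
  assumes "coprime l m" "m > 0"
  shows "bij_betw (\<lambda>j. (k + l * j) mod m) {..<m} {..<m}"
proof -
  have "inj_on (\<lambda>j. (k + l * j) mod m) {..<m}"
  proof (rule linorder_inj_onI)
    fix i j assume "i < j" "i \<in> {..<m}" "j \<in> {..<m}"
    then show "(k + l * i) mod m \<noteq> (k + l * j) mod m"
    proof (intro notI)
      assume "(k + l * i) mod m = (k + l * j) mod m"
      then have "m dvd (k + l * j) - (k + l * i)"
        by (metis \<open>i < j\<close> add_le_cancel_left less_imp_le_nat mod_eq_dvd_iff_nat mult_le_mono2)
      then have "m dvd l * (j - i)" by (simp add: diff_mult_distrib2)
      then have "m dvd j - i" using assms by (simp add: coprime_commute coprime_dvd_mult_right_iff)
      then show False using \<open>i < j\<close> \<open>j \<in> {..<m}\<close> by (auto dest: dvd_imp_le)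
    qed
  qed (auto)
  moreover have "(\<lambda>j. (k + l * j) mod m) ` {..<m} \<subseteq> {..<m}" using assms by auto
  ultimately show ?thesis
    by (simp add: bij_betw_def endo_inj_surj)
qed

text \<open>The distribution relation. With \<open>l * u = t + k\<close>, the arguments are
  \<open>(t + k + l j) / m\<close>; as \<open>l\<close> is invertible modulo \<open>m\<close>, the
  residues of \<open>k + l j\<close> run through all classes, and an arithmetic progression remains
  to be summed.\<close>

lemma sum_saw_coprime:
  assumes "coprime l m" "m > 0" "0 \<le> u"
  shows "(\<Sum>j<m. saw (real l * ((u + real j) / real m))) = saw (real l * u)"
proof -
  define k where "k = nat \<lfloor>l * u\<rfloor>"
  define t where "t = frac (l * u)"
  have lu: "l * u = t + real k" using assms(3) by (simp add: t_def k_def frac_def)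
  have t: "0 \<le> t" "t < 1" by (auto simp: t_def frac_lt_1)
  have "(\<Sum>j<m. saw (real l * ((u + real j) / real m))) = (\<Sum>j<m. saw ((t + real (k + l * j)) / real m))"
    using lu by (intro sum.cong refl arg_cong[of _ _ saw]) (simp add: algebra_simps)
  also have "\<dots> = (\<Sum>j<m. 1 - 2 * (t + real ((k + l * j) mod m)) / real m)"
    by (intro sum.cong refl saw_add_fraction t assms(2))
  also have "\<dots> = (\<Sum>i<m. 1 - 2 * (t + real i) / real m)"
    by (rule sum.reindex_bij_betw[OF bij_betw_mult_mod[OF assms(1,2)]])
  also have "\<dots> = m - 2 * t - (2 / m) * (\<Sum>i<m. real i)"
    using assms(2) by (simp add: sum_subtractf sum_divide_distrib[symmetric] sum.distrib sum_distrib_left field_simps)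
  also have "(\<Sum>i<m. real i) = real m * (real m - 1) / 2"
    by (induction m) (auto simp: field_simps)
  also have "m - 2 * t - (2 / m) * (real m * (real m - 1) / 2) = 1 - 2 * t"
    using assms(2) by (simp add: field_simps)
  also have "\<dots> = saw (l * u)" by (simp add: saw_def t_def)
  finally show ?thesis .
qed

lemma integrable_saw_mult: "integrable unit_interval (\<lambda>x. saw (a * x) * saw (b * x))"
  by (rule integrable_bounded_unit_interval[where B=1])
    (simp_all add: abs_saw_mult_le)

text \<open>On each of the \<open>m\<close> pieces \<open>saw (m x)\<close> turns into
  \<open>saw u\<close> by periodicity. It factors out, and the distribution relation evaluates the
  sum over the pieces.\<close>

lemma integral_saw_coprime:
  assumes "coprime l m" "m > 0"
  shows "integral\<^sup>L unit_interval (\<lambda>x. saw (real l * x) * saw (real m * x))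
       = integral\<^sup>L unit_interval (\<lambda>x. saw (real l * x) * saw x) / m"
proof -
  have "integral\<^sup>L unit_interval (\<lambda>x. saw (real l * x) * saw (real m * x)) =
     integral\<^sup>L unit_interval (\<lambda>u. \<Sum>j<m. saw (real l * ((u + real j) / real m)) * saw (real m * ((u + real j) / real m))) / m"
    by (rule integral_unit_interval_split[OF integrable_saw_mult assms(2)])
  also have "integral\<^sup>L unit_interval (\<lambda>u. \<Sum>j<m. saw (real l * ((u + real j) / real m)) * saw (real m * ((u + real j) / real m)))
     = integral\<^sup>L unit_interval (\<lambda>x. saw (real l * x) * saw x)"
  proof (rule Bochner_Integration.integral_cong)
    fix u assume "u \<in> space unit_interval"
    then have "0 \<le> u" by simp
    have "saw (real m * ((u + real j) / real m)) = saw u" for j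
      using assms(2) by (simp add: saw_add_of_nat)
    then show "(\<Sum>j<m. saw (real l * ((u + real j) / real m)) * saw (real m * ((u + real j) / real m))) = saw (real l * u) * saw u"
      using sum_saw_coprime[OF assms \<open>0 \<le> u\<close>] by (simp only: sum_distrib_right[symmetric])
  qed simp
  finally show ?thesis .
qed

text \<open>Dilation by a positive integer \<open>d\<close> preserves the mean of a 1-periodic
  function.\<close>

lemma integral_saw_scale:
  assumes "d > 0"
  shows "integral\<^sup>L unit_interval (\<lambda>x. saw (real (d * l) * x) * saw (real (d * m) * x))
       = integral\<^sup>L unit_interval (\<lambda>x. saw (real l * x) * saw (real m * x))"
proof -
  have *: "saw (real (d * l) * ((u + real j) / real d)) = saw (real l * u)" for l u j
  proof -
    have "real (d * l) * ((u + real j) / real d) = real l * u + real (l * j)"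
      using assms by (simp add: field_simps)
    then show ?thesis by (simp only: saw_add_of_nat)
  qed
  show ?thesis
    using assms by (subst integral_unit_interval_split[OF integrable_saw_mult assms]) (simp add: * del: of_nat_mult times_divide_eq_right)
qed

text \<open>Scale out the gcd, then apply the coprime case twice, the second time to 1 and
  \<open>l'\<close>. What remains is the integral of \<open>saw\<close> squared, divided by
  \<open>l' * m'\<close>. That integral is 1/3, but the bound 1 suffices.\<close>

lemma abs_integral_saw_le:
  fixes l m :: nat
  assumes "l > 0" "m > 0"
  shows "\<bar>integral\<^sup>L unit_interval (\<lambda>x. saw (real l * x) * saw (real m * x))\<bar> \<le> real (gcd l m) ^ 2 / (real l * real m)"
proof -
  define d where "d = gcd l m"
  obtain l' m' where l': "l = d * l'" "m = d * m'" "coprime l' m'"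
    using assms gcd_coprime_exists[of l m] unfolding d_def by (metis gcd_eq_0_iff less_irrefl mult.commute)
  have pos: "d > 0" "l' > 0" "m' > 0" using l' assms by (auto intro: Nat.gr0I)
  have "integral\<^sup>L unit_interval (\<lambda>x. saw (real l * x) * saw (real m * x))
     = integral\<^sup>L unit_interval (\<lambda>x. saw (real l' * x) * saw (real m' * x))"
    unfolding l'(1,2) by (rule integral_saw_scale) fact
  also have "\<dots> = integral\<^sup>L unit_interval (\<lambda>x. saw (real l' * x) * saw x) / m'"
    using l' pos by (intro integral_saw_coprime)
  also have "integral\<^sup>L unit_interval (\<lambda>x. saw (real l' * x) * saw x)
     = integral\<^sup>L unit_interval (\<lambda>x. saw (real 1 * x) * saw (real l' * x))" by (simp add: mult.commute)
  also have "\<dots> = integral\<^sup>L unit_interval (\<lambda>x. saw (real 1 * x) * saw x) / l'"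
    using pos by (intro integral_saw_coprime) auto
  finally have eq: "integral\<^sup>L unit_interval (\<lambda>x. saw (real l * x) * saw (real m * x))
     = integral\<^sup>L unit_interval (\<lambda>x. saw x * saw x) / (l' * m')" by simp
  have "\<bar>integral\<^sup>L unit_interval (\<lambda>x. saw x * saw x)\<bar> \<le> integral\<^sup>L unit_interval (\<lambda>x. \<bar>saw x * saw x\<bar>)"
    by (rule integral_abs_bound)
  also have "\<dots> \<le> integral\<^sup>L unit_interval (\<lambda>x. 1)"
    by (rule integral_mono[OF integrable_abs])
      (use integrable_saw_mult[of 1 1] in \<open>simp_all only: abs_saw_mult_le mult_1 unit_interval.integrable_const\<close>)
  also have "\<dots> = 1" by (simp add: measure_unit_interval)
  finally have "\<bar>integral\<^sup>L unit_interval (\<lambda>x. saw x * saw x)\<bar> \<le> 1" .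
  then have "\<bar>integral\<^sup>L unit_interval (\<lambda>x. saw x * saw x) / (l' * m')\<bar> \<le> 1 / (real l' * real m')"
    using pos by (simp add: abs_divide divide_right_mono)
  also have "\<dots> = real d ^ 2 / (real l * real m)"
    using pos by (simp add: l'(1,2) power2_eq_square)
  finally show ?thesis unfolding eq d_def .
qed

section \<open>The gcd sum\<close>

lemma sum_inverse_squares_le:
  assumes "a \<ge> 1"
  shows "(\<Sum>i=a..b. 1 / real i ^ 2) \<le> 2 / real a"
proof (cases "a \<le> b")
  case True
  \<comment> \<open>The extra \<open>- 1 / b\<close> makes the induction telescope.\<close>
  then have "(\<Sum>i=a..b. 1 / real i ^ 2) \<le> 2 / real a - 1 / real b"
  proof (induction rule: dec_induct)
    case base
    have "real a \<le> real a ^ 2" using assms by (simp add: power2_eq_square)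
    then have "1 / real a ^ 2 \<le> 1 / real a" using assms by (simp add: frac_le)
    then show ?case by simp
  next
    case (step b)
    have b: "real b > 0" using assms step.hyps by simp
    have "1 / (real b + 1) ^ 2 \<le> 1 / (real b * (real b + 1))"
      using b by (intro divide_left_mono) (auto simp: power2_eq_square)
    also have "\<dots> = 1 / real b - 1 / (real b + 1)" using b by (simp add: field_simps)
    finally have "1 / (real b + 1) ^ 2 \<le> 1 / real b - 1 / (real b + 1)" .
    then show ?case using step by (simp add: add.commute)
  qed
  then show ?thesis by (smt (verit) divide_nonneg_nonneg of_nat_0_le_iff)
qed simp

text \<open>Substituting \<open>l = d * i\<close> leaves a tail of the sum of inverse squares that
  starts at \<open>i = M div d + 1\<close>.\<close>

lemma sum_inverse_squares_multiples_le:
  assumes "d \<ge> 1"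
  shows "(\<Sum>l | l \<in> {M<..N} \<and> d dvd l. 1 / real l ^ 2) \<le> 2 / (real d ^ 2 * real (M div d + 1))"
proof -
  have "{l. l \<in> {M<..N} \<and> d dvd l} = (*) d ` {M div d + 1..N div d}"
  proof (intro equalityI subsetI)
    fix l assume "l \<in> {l. l \<in> {M<..N} \<and> d dvd l}"
    then obtain i where i: "l = d * i" "M < d * i" "d * i \<le> N" by auto
    have "M div d < i" using i assms by (simp add: less_mult_imp_div_less mult.commute)
    moreover have "i \<le> N div d" using i assms by (simp add: less_eq_div_iff_mult_less_eq mult.commute)
    ultimately show "l \<in> (*) d ` {M div d + 1..N div d}" using i by auto
  next
    fix l assume "l \<in> (*) d ` {M div d + 1..N div d}"
    then obtain i where i: "l = d * i" "M div d < i" "i \<le> N div d" by fastforce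
    have "d * i \<le> N" using i assms by (simp add: less_eq_div_iff_mult_less_eq mult.commute)
    moreover have "M < d * i" using i(2) assms by (simp add: div_less_iff_less_mult mult.commute)
    ultimately show "l \<in> {l. l \<in> {M<..N} \<and> d dvd l}" using i by auto
  qed
  moreover have "inj_on ((*) d) {M div d + 1..N div d}" using assms by (auto simp: inj_on_def)
  ultimately have "(\<Sum>l | l \<in> {M<..N} \<and> d dvd l. 1 / real l ^ 2)
      = (\<Sum>i=M div d + 1..N div d. 1 / real (d * i) ^ 2)"
    by (simp only: sum.reindex o_def)
  also have "\<dots> = (\<Sum>i=M div d + 1..N div d. 1 / real i ^ 2) / real d ^ 2"
    by (simp add: power_mult_distrib sum_divide_distrib mult.commute)
  also have "\<dots> \<le> (2 / real (M div d + 1)) / real d ^ 2"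
    by (intro divide_right_mono sum_inverse_squares_le) auto
  finally show ?thesis by (simp add: mult.commute)
qed

text \<open>Bound the squared gcd by the sum of \<open>d ^ 2\<close> over all common divisors
  \<open>d\<close>. After exchanging sums, each \<open>d\<close> contributes
  \<open>d ^ 2 * T d ^ 2\<close>. The \<open>M\<close> values \<open>d \<le> M\<close> give at most
  \<open>4 / M\<close>, the larger ones at most \<open>8 / M\<close>.\<close>

lemma sum_gcd_squares_le:
  assumes M: "1 \<le> M" "M \<le> N"
  shows "(\<Sum>l\<in>{M<..N}. \<Sum>m\<in>{M<..N}. real (gcd l m) ^ 2 / (real l ^ 2 * real m ^ 2)) \<le> 12 / real M"
proof -
  define A where "A = {M<..N}"
  define T where "T d = (\<Sum>l | l \<in> A \<and> d dvd l. 1 / real l ^ 2)" for d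
  have T_alt: "T d = (\<Sum>l\<in>A. (if d dvd l then 1 / real l ^ 2 else 0))" for d
    unfolding T_def A_def by (subst sum.inter_filter) auto
  have T_square: "T d ^ 2 = (\<Sum>l\<in>A. \<Sum>m\<in>A. (if d dvd l then 1 / real l ^ 2 else 0) * (if d dvd m then 1 / real m ^ 2 else 0))" for d
    unfolding T_alt power2_eq_square sum_product ..
  have gcd_le: "real (gcd l m) ^ 2 \<le> (\<Sum>d=1..N. if d dvd l \<and> d dvd m then real d ^ 2 else 0)"
    if "l \<in> A" "m \<in> A" for l m
  proof -
    have "gcd l m \<le> l" "l > 0" "l \<le> N" using that by (auto simp: A_def intro: gcd_le1_nat)
    then have "gcd l m \<in> {1..N}" unfolding atLeastAtMost_iff
      by (metis One_nat_def Suc_leI gcd_pos_nat le_trans neq0_conv)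
    then show ?thesis
      using member_le_sum[of "gcd l m" "{1..N}" "\<lambda>d. if d dvd l \<and> d dvd m then real d ^ 2 else 0"] by simp
  qed
  have d_le: "real d ^ 2 * T d ^ 2 \<le> (if d \<le> M then 4 / real M ^ 2 else 4 / real d ^ 2)" if "d \<ge> 1" for d
  proof -
    define a where "a = M div d + 1"
    have "T d \<le> 2 / (real d ^ 2 * real a)"
      unfolding T_def A_def a_def by (rule sum_inverse_squares_multiples_le[OF that])
    moreover have "0 \<le> T d" unfolding T_def by (intro sum_nonneg) auto
    ultimately have "real d ^ 2 * T d ^ 2 \<le> real d ^ 2 * (2 / (real d ^ 2 * real a)) ^ 2"
      by (intro mult_left_mono power_mono) auto
    also have "\<dots> = 4 / (real d * real a) ^ 2"
      using that by (simp add: power2_eq_square field_simps)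
    also have "\<dots> \<le> (if d \<le> M then 4 / real M ^ 2 else 4 / real d ^ 2)"
    proof -
      \<comment> \<open>Rounding up in \<open>a\<close> makes \<open>d * a\<close> exceed
        \<open>M\<close>, which yields the bound for small \<open>d\<close>; for large
        \<open>d\<close> it is enough that \<open>a\<close> is at least 1.\<close>
      have "M \<le> d * a"
        using that dividend_less_div_times[of d M] by (simp add: a_def algebra_simps)
      then have "real M \<le> real d * real a" by (metis of_nat_le_iff of_nat_mult)
      moreover have "real d \<le> real d * real a" using that by (simp add: a_def)
      ultimately show ?thesis using that M by (auto intro!: divide_left_mono power_mono)
    qed
    finally show ?thesis .
  qed
  have "(\<Sum>l\<in>A. \<Sum>m\<in>A. real (gcd l m) ^ 2 / (real l ^ 2 * real m ^ 2))
     \<le> (\<Sum>l\<in>A. \<Sum>m\<in>A. (\<Sum>d=1..N. if d dvd l \<and> d dvd m then real d ^ 2 else 0) / (real l ^ 2 * real m ^ 2))"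
    by (intro sum_mono divide_right_mono gcd_le) auto
  also have "\<dots> = (\<Sum>l\<in>A. \<Sum>m\<in>A. \<Sum>d=1..N. real d ^ 2 * ((if d dvd l then 1 / real l ^ 2 else 0) * (if d dvd m then 1 / real m ^ 2 else 0)))"
    unfolding sum_divide_distrib by (intro sum.cong refl) auto
  also have "\<dots> = (\<Sum>l\<in>A. \<Sum>d=1..N. \<Sum>m\<in>A. real d ^ 2 * ((if d dvd l then 1 / real l ^ 2 else 0) * (if d dvd m then 1 / real m ^ 2 else 0)))"
    by (intro sum.cong refl sum.swap)
  also have "\<dots> = (\<Sum>d=1..N. \<Sum>l\<in>A. \<Sum>m\<in>A. real d ^ 2 * ((if d dvd l then 1 / real l ^ 2 else 0) * (if d dvd m then 1 / real m ^ 2 else 0)))"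
    by (rule sum.swap)
  also have "\<dots> = (\<Sum>d=1..N. real d ^ 2 * T d ^ 2)"
    by (simp only: T_square sum_distrib_left)
  also have "\<dots> \<le> (\<Sum>d=1..N. if d \<le> M then 4 / real M ^ 2 else 4 / real d ^ 2)"
    by (intro sum_mono d_le) simp
  also have "{1..N} = {1..M} \<union> {M+1..N}" using M by auto
  also have "(\<Sum>d\<in>{1..M} \<union> {M+1..N}. if d \<le> M then 4 / real M ^ 2 else 4 / real d ^ 2)
      = (\<Sum>d=1..M. 4 / real M ^ 2) + (\<Sum>d=M+1..N. 4 * (1 / real d ^ 2))"
    by (subst sum.union_disjoint) (auto intro!: sum.cong)
  also have "\<dots> \<le> 4 / real M + 4 * (2 / real (M + 1))"
    unfolding sum_distrib_left[symmetric]
    by (intro add_mono mult_left_mono sum_inverse_squares_le) (use M in \<open>auto simp: power2_eq_square\<close>)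
  also have "\<dots> \<le> 4 / real M + 4 * (2 / real M)"
    using M by (intro add_left_mono mult_left_mono divide_left_mono) auto
  finally show ?thesis by (simp add: A_def)
qed

section \<open>Convergence of the series and its moments\<close>

text \<open>Because of the index shift in \<open>g_term\<close>, this covers the original indices 1
  to \<open>N\<close>.\<close>

definition partial :: "nat \<Rightarrow> real \<Rightarrow> real" where
  "partial N x = (\<Sum>l<N. g_term x l)"

lemma g_term_saw: "g_term x l = saw (real (Suc l) * x) / real (Suc l)"
  by (simp add: g_term_def saw_def)

lemma g_term_measurable [measurable]: "(\<lambda>x. g_term x l) \<in> borel_measurable borel"
  unfolding g_term_saw by measurable

lemma partial_measurable [measurable]: "partial N \<in> borel_measurable borel"
  unfolding partial_def by measurable

lemma partial_diff:
  assumes "M \<le> N"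
  shows "partial N x - partial M x = (\<Sum>l\<in>{M<..N}. saw (real l * x) / real l)"
proof -
  have "partial N x - partial M x = (\<Sum>l\<in>{M..<N}. g_term x l)"
    using sum_diff_nat_ivl[of 0 M N "g_term x"] assms by (simp add: partial_def atLeast0LessThan)
  also have "\<dots> = (\<Sum>l\<in>{Suc M..<Suc N}. saw (real l * x) / real l)"
    unfolding g_term_saw by (rule sum.shift_bounds_Suc_ivl[symmetric])
  also have "{Suc M..<Suc N} = {M<..N}" by auto
  finally show ?thesis .
qed

text \<open>A pointwise bound from the size of the terms alone. It fills the gaps between
  consecutive fourth powers and gives linear growth along powers of 4.\<close>

lemma abs_partial_diff_le:
  assumes "1 \<le> M" "M \<le> N"
  shows "\<bar>partial N x - partial M x\<bar> \<le> (real N - real M) / real M"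
proof -
  have "\<bar>partial N x - partial M x\<bar> \<le> (\<Sum>l\<in>{M<..N}. \<bar>saw (real l * x) / real l\<bar>)"
    unfolding partial_diff[OF assms(2)] by (rule sum_abs)
  also have "\<dots> \<le> (\<Sum>l\<in>{M<..N}. 1 / real M)"
    unfolding abs_divide by (intro sum_mono frac_le abs_saw_le) (use assms in auto)
  finally show ?thesis using assms by (simp add: of_nat_diff)
qed

lemma abs_partial_le: "\<bar>partial N x\<bar> \<le> real N"
proof -
  have "\<bar>partial N x\<bar> \<le> (\<Sum>l<N. \<bar>g_term x l\<bar>)"
    unfolding partial_def by (rule sum_abs)
  also have "\<dots> \<le> (\<Sum>l<N. 1)"
  proof (intro sum_mono)
    fix l
    have "\<bar>saw (real (Suc l) * x)\<bar> \<le> 1" by (rule abs_saw_le)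
    then show "\<bar>g_term x l\<bar> \<le> 1" unfolding g_term_saw abs_divide by (simp add: field_simps)
  qed
  finally show ?thesis by simp
qed

lemma abs_power_le: "\<bar>a\<bar> \<le> c \<Longrightarrow> \<bar>a ^ p\<bar> \<le> c ^ p" for a c :: real
  by (simp add: power_abs power_mono)

lemma integrable_partial_diff_power:
  "integrable unit_interval (\<lambda>x. (partial N x - partial M x) ^ p)"
proof (rule integrable_bounded_unit_interval)
  show "\<bar>(partial N x - partial M x) ^ p\<bar> \<le> (real N + real M) ^ p" for x
    using abs_partial_le[of N x] abs_partial_le[of M x] by (intro abs_power_le) linarith
qed measurable

text \<open>Expanding the square, the coefficients contribute a further \<open>1 / (l * m)\<close>
  to each correlation bound, which produces the gcd sum.\<close>

lemma integral_partial_diff_square_le: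
  assumes "1 \<le> M" "M \<le> N"
  shows "integral\<^sup>L unit_interval (\<lambda>x. (partial N x - partial M x) ^ 2) \<le> 12 / real M"
proof -
  have int: "integrable unit_interval (\<lambda>x. saw (real l * x) / real l * (saw (real m * x) / real m))" for l m
    using integrable_mult_left[of "1 / (real l * real m)" unit_interval, OF integrable_saw_mult[of l m]] by simp
  have "integral\<^sup>L unit_interval (\<lambda>x. (partial N x - partial M x) ^ 2)
    = integral\<^sup>L unit_interval (\<lambda>x. \<Sum>l\<in>{M<..N}. \<Sum>m\<in>{M<..N}. saw (real l * x) / real l * (saw (real m * x) / real m))"
    unfolding partial_diff[OF assms(2)] power2_eq_square sum_product ..
  also have "\<dots> = (\<Sum>l\<in>{M<..N}. \<Sum>m\<in>{M<..N}. integral\<^sup>L unit_interval (\<lambda>x. saw (real l * x) / real l * (saw (real m * x) / real m)))"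
    by (simp add: Bochner_Integration.integral_sum int Bochner_Integration.integrable_sum del: times_divide_eq_left times_divide_eq_right)
  also have "\<dots> \<le> (\<Sum>l\<in>{M<..N}. \<Sum>m\<in>{M<..N}. real (gcd l m) ^ 2 / (real l ^ 2 * real m ^ 2))"
  proof (intro sum_mono)
    fix l m assume "l \<in> {M<..N}" "m \<in> {M<..N}"
    then have pos: "l > 0" "m > 0" using assms by auto
    have "integral\<^sup>L unit_interval (\<lambda>x. saw (real l * x) / real l * (saw (real m * x) / real m))
      = integral\<^sup>L unit_interval (\<lambda>x. saw (real l * x) * saw (real m * x)) / (real l * real m)"
      by simp
    also have "\<dots> \<le> (real (gcd l m) ^ 2 / (real l * real m)) / (real l * real m)"
      using abs_integral_saw_le[OF pos] by (intro divide_right_mono) auto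
    also have "\<dots> = real (gcd l m) ^ 2 / (real l ^ 2 * real m ^ 2)"
      by (simp add: power2_eq_square mult.assoc mult.left_commute)
    finally show "integral\<^sup>L unit_interval (\<lambda>x. saw (real l * x) / real l * (saw (real m * x) / real m))
      \<le> real (gcd l m) ^ 2 / (real l ^ 2 * real m ^ 2)" .
  qed
  also have "\<dots> \<le> 12 / real M" by (rule sum_gcd_squares_le[OF assms])
  finally show ?thesis .
qed

text \<open>Fatou's lemma in a form that also yields integrability of the limit. It transfers both
  the mean square bound and the moment bounds from partial sums to \<open>g\<close>.\<close>

lemma Fatou_integrable:
  fixes f :: "'a \<Rightarrow> real"
  assumes int: "\<And>n. integrable M (u n)"
    and nonneg: "\<And>n x. 0 \<le> u n x"
    and lim: "AE x in M. (\<lambda>n. u n x) \<longlonglongrightarrow> f x"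
    and f: "f \<in> borel_measurable M"
    and le: "\<And>n. integral\<^sup>L M (u n) \<le> C"
  shows "integrable M f" and "integral\<^sup>L M f \<le> C"
proof -
  have "0 \<le> integral\<^sup>L M (u 0)" by (intro integral_nonneg_AE) (simp add: nonneg)
  with le[of 0] have C: "0 \<le> C" by linarith
  have f_nonneg: "AE x in M. 0 \<le> f x"
    using lim by eventually_elim (use nonneg in \<open>auto intro: LIMSEQ_le_const\<close>)
  have "(\<integral>\<^sup>+x. ennreal (f x) \<partial>M) = (\<integral>\<^sup>+x. liminf (\<lambda>n. ennreal (u n x)) \<partial>M)"
    using lim
  proof (intro nn_integral_cong_AE, eventually_elim)
    fix x assume "(\<lambda>n. u n x) \<longlonglongrightarrow> f x"
    then have "(\<lambda>n. ennreal (u n x)) \<longlonglongrightarrow> ennreal (f x)" by (rule tendsto_ennrealI)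
    then show "ennreal (f x) = liminf (\<lambda>n. ennreal (u n x))"
      by (simp add: lim_imp_Liminf)
  qed
  also have "\<dots> \<le> liminf (\<lambda>n. \<integral>\<^sup>+x. ennreal (u n x) \<partial>M)"
    using int by (intro nn_integral_liminf) auto
  also have "\<dots> \<le> liminf (\<lambda>n::nat. ennreal C)"
    using int nonneg le by (intro Liminf_mono always_eventually allI) (simp add: nn_integral_eq_integral ennreal_leI)
  also have "\<dots> = ennreal C" by (simp add: Liminf_const)
  finally have *: "(\<integral>\<^sup>+x. ennreal (f x) \<partial>M) \<le> ennreal C" .
  then show int_f: "integrable M f"
    using f f_nonneg by (intro integrableI_nonneg) (auto intro: le_less_trans)
  show "integral\<^sup>L M f \<le> C"
    using * C by (simp add: nn_integral_eq_integral[OF int_f f_nonneg])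
qed

text \<open>Passes from mean square to mean by the inequality of arithmetic and geometric means with
  a free weight \<open>s\<close>. A good choice is \<open>s\<close> of the order of the square root
  of \<open>M\<close>, giving decay like the inverse of that root.\<close>

lemma integral_abs_partial_diff_le:
  assumes "1 \<le> M" "M \<le> N" "s > 0"
  shows "integral\<^sup>L unit_interval (\<lambda>x. \<bar>partial N x - partial M x\<bar>) \<le> (12 * s / real M + 1 / s) / 2"
proof -
  have "integral\<^sup>L unit_interval (\<lambda>x. \<bar>partial N x - partial M x\<bar>)
     \<le> integral\<^sup>L unit_interval (\<lambda>x. s / 2 * (partial N x - partial M x) ^ 2 + 1 / (2 * s))"
  proof (rule integral_mono)
    show "integrable unit_interval (\<lambda>x. \<bar>partial N x - partial M x\<bar>)"
      using integrable_abs[OF integrable_partial_diff_power[of N M 1]] by simp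
    show "integrable unit_interval (\<lambda>x. s / 2 * (partial N x - partial M x) ^ 2 + 1 / (2 * s))"
      using integrable_partial_diff_power by simp
    have "\<bar>y\<bar> \<le> s / 2 * y ^ 2 + 1 / (2 * s)" for y
    proof -
      have "0 \<le> (s * \<bar>y\<bar> - 1) ^ 2 / (2 * s)" using assms by simp
      also have "\<dots> = s / 2 * y ^ 2 + 1 / (2 * s) - \<bar>y\<bar>"
        using assms by (simp add: power2_eq_square field_simps)
      finally show ?thesis by simp
    qed
    then show "\<bar>partial N x - partial M x\<bar> \<le> s / 2 * (partial N x - partial M x) ^ 2 + 1 / (2 * s)" for x .
  qed
  also have "\<dots> = s / 2 * integral\<^sup>L unit_interval (\<lambda>x. (partial N x - partial M x) ^ 2) + 1 / (2 * s)"
    using integrable_partial_diff_power[of N M 2] by (simp add: measure_unit_interval)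
  also have "\<dots> \<le> s / 2 * (12 / real M) + 1 / (2 * s)"
    using assms by (intro add_right_mono mult_left_mono integral_partial_diff_square_le) auto
  also have "\<dots> = (12 * s / real M + 1 / s) / 2" by simp
  finally show ?thesis .
qed

text \<open>Fourth powers are sparse enough that the mean increments are of order
  \<open>1 / j ^ 2\<close>, hence summable, yet dense enough that the ratio of neighbours tends to
  1, which is needed to fill the gaps afterwards.\<close>

lemma AE_summable_blocks:
  "AE x in unit_interval. summable (\<lambda>j. \<bar>partial ((Suc j + 1) ^ 4) x - partial ((j + 1) ^ 4) x\<bar>)"
proof -
  define D where "D j x = \<bar>partial ((Suc j + 1) ^ 4) x - partial ((j + 1) ^ 4) x\<bar>" for j x
  have D_meas [measurable]: "D j \<in> borel_measurable unit_interval" for j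
    unfolding D_def by (intro measurable_unit_interval) measurable
  have "(\<integral>\<^sup>+x. ennreal (D j x) \<partial>unit_interval) \<le> ennreal (7 * (1 / real (Suc j) ^ 2))" for j
  proof -
    have "(\<integral>\<^sup>+x. ennreal (D j x) \<partial>unit_interval) = ennreal (integral\<^sup>L unit_interval (D j))"
      using integrable_abs[OF integrable_partial_diff_power[of "(Suc j + 1) ^ 4" "(j + 1) ^ 4" 1]]
      by (intro nn_integral_eq_integral) (auto simp: D_def)
    \<comment> \<open>Here \<open>s = (j + 1) ^ 2\<close>, the square root of the lower
      index.\<close>
    also have "integral\<^sup>L unit_interval (D j) \<le> (12 * real ((j + 1) ^ 2) / real ((j + 1) ^ 4) + 1 / real ((j + 1) ^ 2)) / 2"
      unfolding D_def by (intro integral_abs_partial_diff_le power_mono) auto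
    also have "\<dots> = 13 / 2 * (1 / real (Suc j) ^ 2)"
    proof -
      have "12 * c ^ 2 / c ^ 4 + 1 / c ^ 2 = 13 / c ^ 2" if "c > 0" for c :: real
        using that by (simp add: power2_eq_square power4_eq_xxxx)
      from this[of "real (Suc j)"] show ?thesis by simp
    qed
    also have "\<dots> \<le> 7 * (1 / real (Suc j) ^ 2)" by (intro mult_right_mono) auto
    finally show ?thesis by (simp add: ennreal_leI)
  qed
  then have "(\<integral>\<^sup>+x. (\<Sum>j. ennreal (D j x)) \<partial>unit_interval) \<le> (\<Sum>j. ennreal (7 * (1 / real (Suc j) ^ 2)))"
    by (subst nn_integral_suminf) (auto intro!: suminf_le)
  also have "\<dots> = ennreal (\<Sum>j. 7 * (1 / real (Suc j) ^ 2))"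
  proof (rule suminf_ennreal2)
    have "summable (\<lambda>j. inverse (real (Suc j) ^ 2))"
      using inverse_power_summable[of 2, where 'a=real] by (subst summable_Suc_iff) simp
    then show "summable (\<lambda>j. 7 * (1 / real (Suc j) ^ 2))"
      unfolding inverse_eq_divide by (rule summable_mult)
  qed auto
  also have "\<dots> < \<infinity>" by simp
  finally have "AE x in unit_interval. (\<Sum>j. ennreal (D j x)) \<noteq> \<infinity>"
    by (intro nn_integral_PInf_AE) auto
  then show ?thesis
    unfolding D_def[symmetric]
  proof eventually_elim
    fix x assume "(\<Sum>j. ennreal (D j x)) \<noteq> \<infinity>"
    then show "summable (\<lambda>j. D j x)"
      by (intro summable_suminf_not_top) (simp_all add: D_def)
  qed
qed

text \<open>Telescoping gives convergence along fourth powers. Any \<open>n\<close> is compared with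
  the largest fourth power below or equal to it; the difference is at most
  \<open>((r + 1) ^ 4 - r ^ 4) / r ^ 4\<close>, which tends to 0.\<close>

lemma AE_summable_g_term: "AE x in unit_interval. summable (g_term x)"
  using AE_summable_blocks
proof eventually_elim
  fix x assume "summable (\<lambda>j. \<bar>partial ((Suc j + 1) ^ 4) x - partial ((j + 1) ^ 4) x\<bar>)"
  then have "summable (\<lambda>j. partial ((Suc j + 1) ^ 4) x - partial ((j + 1) ^ 4) x)"
    by (rule summable_rabs_cancel)
  then have "convergent (\<lambda>j. partial ((j + 1) ^ 4) x)"
    unfolding summable_iff_convergent sum_lessThan_telescope[of "\<lambda>j. partial ((j + 1) ^ 4) x"]
    by (subst (asm) convergent_diff_const_right_iff)
  then obtain L where "(\<lambda>j. partial ((j + 1) ^ 4) x) \<longlonglongrightarrow> L" by (auto simp: convergent_def)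
  then have L: "(\<lambda>j. partial (j ^ 4) x) \<longlonglongrightarrow> L"
    by (subst filterlim_sequentially_Suc[symmetric]) simp
  define r where "r n = nat \<lfloor>root 4 (real n)\<rfloor>" for n
  have r: "r n ^ 4 \<le> n" "n < (r n + 1) ^ 4" for n
  proof -
    have nonneg: "0 \<le> root 4 (real n)" by simp
    have "real (r n) \<le> root 4 (real n)" "root 4 (real n) < real (r n + 1)"
      unfolding r_def using nonneg by linarith+
    then have "real (r n) ^ 4 \<le> root 4 (real n) ^ 4" "root 4 (real n) ^ 4 < real (r n + 1) ^ 4"
      using nonneg by (intro power_mono power_strict_mono; simp)+
    moreover have "root 4 (real n) ^ 4 = real n" by simp
    ultimately show "r n ^ 4 \<le> n" "n < (r n + 1) ^ 4"
      by (metis of_nat_le_iff of_nat_power, metis of_nat_less_iff of_nat_power)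
  qed
  have r_lim: "filterlim r at_top sequentially"
    unfolding filterlim_at_top eventually_sequentially
  proof (intro allI exI impI)
    fix Z n :: nat assume "Z ^ 4 \<le> n"
    then have "Z ^ 4 < (r n + 1) ^ 4" using r(2)[of n] by simp
    then show "Z \<le> r n" using power_less_imp_less_base by fastforce
  qed
  have "(\<lambda>n. partial n x - partial (r n ^ 4) x) \<longlonglongrightarrow> 0"
  proof (rule Lim_null_comparison)
    show "\<forall>\<^sub>F n in sequentially. norm (partial n x - partial (r n ^ 4) x)
       \<le> (real ((r n + 1) ^ 4) - real (r n ^ 4)) / real (r n ^ 4)"
      using r_lim[unfolded filterlim_at_top, rule_format, of 1]
    proof eventually_elim
      fix n assume "1 \<le> r n"
      then have "\<bar>partial n x - partial (r n ^ 4) x\<bar> \<le> (real n - real (r n ^ 4)) / real (r n ^ 4)"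
        using r(1)[of n] by (intro abs_partial_diff_le) auto
      also have "\<dots> \<le> (real ((r n + 1) ^ 4) - real (r n ^ 4)) / real (r n ^ 4)"
        using r(2)[of n] by (intro divide_right_mono diff_right_mono) (simp_all only: of_nat_le_iff less_imp_le of_nat_0_le_iff)
      finally show "norm (partial n x - partial (r n ^ 4) x)
         \<le> (real ((r n + 1) ^ 4) - real (r n ^ 4)) / real (r n ^ 4)" by simp
    qed
    have "(\<lambda>j::nat. (real ((j + 1) ^ 4) - real (j ^ 4)) / real (j ^ 4)) \<longlonglongrightarrow> 0"
    proof (rule Lim_transform_eventually)
      have "(\<lambda>j. (1 + 1 / real j) ^ 4 - 1) \<longlonglongrightarrow> (1 + 0) ^ 4 - 1"
        by (intro tendsto_intros lim_1_over_n)
      then show "(\<lambda>j. (1 + 1 / real j) ^ 4 - 1) \<longlonglongrightarrow> 0" by simp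
      show "\<forall>\<^sub>F j in sequentially. (1 + 1 / real j) ^ 4 - 1 = (real ((j + 1) ^ 4) - real (j ^ 4)) / real (j ^ 4)"
        using eventually_gt_at_top[of 0]
      proof eventually_elim
        fix j :: nat assume "0 < j"
        then have "1 + 1 / real j = real (j + 1) / real j" by (simp add: field_simps)
        then show "(1 + 1 / real j) ^ 4 - 1 = (real ((j + 1) ^ 4) - real (j ^ 4)) / real (j ^ 4)"
          using \<open>0 < j\<close> by (simp add: power_divide diff_divide_distrib)
      qed
    qed
    from filterlim_compose[OF this r_lim]
    show "(\<lambda>n. (real ((r n + 1) ^ 4) - real (r n ^ 4)) / real (r n ^ 4)) \<longlonglongrightarrow> 0" .
  qed
  from tendsto_add[OF this filterlim_compose[OF L r_lim]]
  have "(\<lambda>n. partial n x) \<longlonglongrightarrow> L" by simp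
  then show "summable (g_term x)"
    unfolding summable_iff_convergent partial_def convergent_def by blast
qed

lemma AE_partial_tendsto_g: "AE x in unit_interval. (\<lambda>n. partial n x) \<longlonglongrightarrow> g x"
  using AE_summable_g_term
  by eventually_elim (simp add: g_def partial_def summable_LIMSEQ)

text \<open>Summability is rewritten as the Cauchy property of the partial sums, whose set of points
  is measurable.\<close>

lemma g_measurable [measurable]: "g \<in> borel_measurable borel"
proof -
  have "summable (g_term x) \<longleftrightarrow> Cauchy (\<lambda>n. partial n x)" for x
    unfolding summable_iff_convergent Cauchy_convergent_iff partial_def ..
  then have g_eq: "g = (\<lambda>x. if Cauchy (\<lambda>n. partial n x) then (\<Sum>l. g_term x l) else 0)"
    by (simp add: g_def fun_eq_iff)
  have "Measurable.pred borel (\<lambda>x. Cauchy (\<lambda>n. partial n x))"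
    unfolding pred_def using sets_Collect_Cauchy[of partial borel] by simp
  moreover have "(\<lambda>x. \<Sum>l. g_term x l) \<in> borel_measurable borel"
    by (rule borel_measurable_suminf) measurable
  ultimately show ?thesis
    unfolding g_eq by (intro measurable_If) (auto simp: pred_def)
qed

lemma g_minus_partial_square:
  assumes "1 \<le> M"
  shows "integrable unit_interval (\<lambda>x. (g x - partial M x) ^ 2)"
    and "integral\<^sup>L unit_interval (\<lambda>x. (g x - partial M x) ^ 2) \<le> 12 / real M"
proof -
  \<comment> \<open>The shift by \<open>M\<close> keeps the upper index at least \<open>M\<close>,
    as the mean square bound for partial sums demands.\<close>
  have lim: "AE x in unit_interval. (\<lambda>n. (partial (n + M) x - partial M x) ^ 2) \<longlonglongrightarrow> (g x - partial M x) ^ 2"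
    using AE_partial_tendsto_g
    by eventually_elim (intro tendsto_intros LIMSEQ_ignore_initial_segment)
  have meas: "(\<lambda>x. (g x - partial M x) ^ 2) \<in> borel_measurable unit_interval"
    by (rule measurable_unit_interval) measurable
  have le: "integral\<^sup>L unit_interval (\<lambda>x. (partial (n + M) x - partial M x) ^ 2) \<le> 12 / real M" for n
    using assms by (intro integral_partial_diff_square_le) auto
  show "integrable unit_interval (\<lambda>x. (g x - partial M x) ^ 2)"
    by (rule Fatou_integrable(1)[OF integrable_partial_diff_power zero_le_power2 lim meas le])
  show "integral\<^sup>L unit_interval (\<lambda>x. (g x - partial M x) ^ 2) \<le> 12 / real M"
    by (rule Fatou_integrable(2)[OF integrable_partial_diff_power zero_le_power2 lim meas le])
qed

section \<open>Finiteness of the even moments\<close>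

lemma abs_power_diff_le:
  fixes a b c :: real
  assumes "\<bar>a\<bar> \<le> c" "\<bar>b\<bar> \<le> c" "1 \<le> c"
  shows "\<bar>a ^ p - b ^ p\<bar> \<le> real p * c ^ p * \<bar>a - b\<bar>"
proof (induction p)
  case (Suc p)
  have "\<bar>a ^ Suc p - b ^ Suc p\<bar> = \<bar>a * (a ^ p - b ^ p) + b ^ p * (a - b)\<bar>"
    by (simp add: algebra_simps)
  also have "\<dots> \<le> \<bar>a\<bar> * \<bar>a ^ p - b ^ p\<bar> + \<bar>b ^ p\<bar> * \<bar>a - b\<bar>"
    by (simp add: abs_triangle_ineq flip: abs_mult)
  also have "\<dots> \<le> c * (real p * c ^ p * \<bar>a - b\<bar>) + c ^ Suc p * \<bar>a - b\<bar>"
  proof (intro add_mono mult_mono Suc.IH assms(1))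
    have "\<bar>b ^ p\<bar> \<le> c ^ p" by (rule abs_power_le[OF assms(2)])
    \<comment> \<open>Thanks to \<open>1 \<le> c\<close>, the exponent \<open>p\<close> can replace
      the sharp \<open>p - 1\<close>, which avoids truncated subtraction at
      \<open>p = 0\<close>.\<close>
    also have "\<dots> \<le> c ^ Suc p" using assms(3) by (intro power_increasing) auto
    finally show "\<bar>b ^ p\<bar> \<le> c ^ Suc p" .
  qed (use assms in auto)
  also have "\<dots> = real (Suc p) * c ^ Suc p * \<bar>a - b\<bar>" by (simp add: algebra_simps)
  finally show ?case .
qed simp

text \<open>Consecutive terms have ratio tending to 1/2, so the ratio is eventually below
  3/4.\<close>

lemma summable_linear_power_half: "summable (\<lambda>j. (3 * real j + 4) ^ p * (1 / 2) ^ j)"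
proof -
  have "(\<lambda>j. 3 / (3 * real j + 4)) \<longlonglongrightarrow> 0"
    by (intro real_tendsto_divide_at_top[OF tendsto_const]
        filterlim_at_top_mono[OF filterlim_real_sequentially]) auto
  then have "(\<lambda>j. (1 + 3 / (3 * real j + 4)) ^ p) \<longlonglongrightarrow> (1 + 0) ^ p"
    by (intro tendsto_intros)
  then have "\<forall>\<^sub>F j in sequentially. (1 + 3 / (3 * real j + 4)) ^ p < 3 / 2"
    by (rule order_tendstoD) simp
  then obtain J where J: "\<And>j. j \<ge> J \<Longrightarrow> (1 + 3 / (3 * real j + 4)) ^ p < 3 / 2"
    by (auto simp: eventually_sequentially)
  show ?thesis
  proof (rule summable_ratio_test[of "3 / 4" J])
    fix j assume "J \<le> j"
    have "3 * real (Suc j) + 4 = (3 * real j + 4) * (1 + 3 / (3 * real j + 4))"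
      by (simp add: field_simps)
    then have "(3 * real (Suc j) + 4) ^ p * (1 / 2) ^ Suc j
       = (1 + 3 / (3 * real j + 4)) ^ p / 2 * ((3 * real j + 4) ^ p * (1 / 2) ^ j)"
      by (simp only: power_mult_distrib) simp
    also have "\<dots> \<le> 3 / 4 * ((3 * real j + 4) ^ p * (1 / 2) ^ j)"
      using J[OF \<open>J \<le> j\<close>] by (intro mult_right_mono) auto
    finally show "norm ((3 * real (Suc j) + 4) ^ p * (1 / 2) ^ Suc j)
      \<le> 3 / 4 * norm ((3 * real j + 4) ^ p * (1 / 2) ^ j)" by simp
  qed simp
qed

lemma abs_partial_power4_le: "\<bar>partial (4 ^ j) x\<bar> \<le> 3 * real j + 1"
proof (induction j)
  case 0
  then show ?case using abs_partial_le[of 1 x] by simp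
next
  case (Suc j)
  have "\<bar>partial (4 ^ Suc j) x - partial (4 ^ j) x\<bar> \<le> (real (4 ^ Suc j) - real (4 ^ j)) / real (4 ^ j)"
    by (intro abs_partial_diff_le) auto
  also have "\<dots> = 3" by simp
  finally show ?case using Suc by simp
qed

text \<open>Without integrability of the even powers, \<open>H\<close> would take the junk value 0. The partial sums
  along \<open>4 ^ n\<close> grow only linearly while their increments decay exponentially in mean, so
  telescoping the \<open>p\<close>-th powers bounds every moment of \<open>g\<close>.\<close>

lemma integrable_g_even_power:
  assumes "even p"
  shows "integrable unit_interval (\<lambda>x. g x ^ p)"
proof (rule Fatou_integrable(1))
  \<comment> \<open>Bounds the growth of the moment from \<open>4 ^ j\<close> to
    \<open>4 ^ (j + 1)\<close>. Both partial sums are at most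
    \<open>3 * j + 4 = 3 * (j + 1) + 1\<close> in absolute value, and \<open>7 * (1 / 2) ^ j\<close>
    bounds the mean of their difference.\<close>
  define b where "b j = real p * 7 * ((3 * real j + 4) ^ p * (1 / 2) ^ j)" for j
  have b: "summable b" unfolding b_def by (intro summable_mult summable_linear_power_half)
  have b_nonneg: "0 \<le> b j" for j by (simp add: b_def)
  have int: "integrable unit_interval (\<lambda>x. partial N x ^ p)" for N
    using integrable_partial_diff_power[of N 0 p] by (simp add: partial_def)
  then show "integrable unit_interval (\<lambda>x. partial (4 ^ n) x ^ p)" for n .
  show "0 \<le> partial (4 ^ n) x ^ p" for n x
    using assms by (rule zero_le_even_power)
  have sub: "strict_mono (\<lambda>n. 4 ^ n :: nat)" by (rule strict_monoI) simp
  show "AE x in unit_interval. (\<lambda>n. partial (4 ^ n) x ^ p) \<longlonglongrightarrow> g x ^ p"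
    using AE_partial_tendsto_g
    by eventually_elim (use LIMSEQ_subseq_LIMSEQ[OF _ sub] in \<open>auto simp: o_def intro!: tendsto_power\<close>)
  show "(\<lambda>x. g x ^ p) \<in> borel_measurable unit_interval"
    by (rule measurable_unit_interval) measurable
  have step: "integral\<^sup>L unit_interval (\<lambda>x. partial (4 ^ Suc j) x ^ p)
     \<le> integral\<^sup>L unit_interval (\<lambda>x. partial (4 ^ j) x ^ p) + b j" for j
  proof -
    let ?D = "\<lambda>x. \<bar>partial (4 ^ Suc j) x - partial (4 ^ j) x\<bar>"
    have int_D: "integrable unit_interval ?D"
      using integrable_abs[OF integrable_partial_diff_power[of "4 ^ Suc j" "4 ^ j" 1]] by simp
    \<comment> \<open>The weight is \<open>s = 2 ^ j\<close>, the square root of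
      \<open>4 ^ j\<close>.\<close>
    have "integral\<^sup>L unit_interval ?D \<le> (12 * 2 ^ j / real (4 ^ j) + 1 / 2 ^ j) / 2"
      by (intro integral_abs_partial_diff_le) auto
    also have "\<dots> = 13 / 2 * (1 / 2) ^ j"
    proof -
      have "(4::real) ^ j = 2 ^ j * 2 ^ j" by (simp flip: power_mult_distrib)
      then show ?thesis by (simp add: field_simps)
    qed
    also have "\<dots> \<le> 7 * (1 / 2) ^ j" by (intro mult_right_mono) auto
    finally have D_le: "integral\<^sup>L unit_interval ?D \<le> 7 * (1 / 2) ^ j" .
    have "integral\<^sup>L unit_interval (\<lambda>x. partial (4 ^ Suc j) x ^ p)
        \<le> integral\<^sup>L unit_interval (\<lambda>x. partial (4 ^ j) x ^ p + real p * (3 * real j + 4) ^ p * ?D x)"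
    proof (rule integral_mono[OF int])
      show "integrable unit_interval (\<lambda>x. partial (4 ^ j) x ^ p + real p * (3 * real j + 4) ^ p * ?D x)"
        using int_D int by (intro Bochner_Integration.integrable_add integrable_mult_right)
      show "partial (4 ^ Suc j) x ^ p \<le> partial (4 ^ j) x ^ p + real p * (3 * real j + 4) ^ p * ?D x" for x
        using abs_power_diff_le[of "partial (4 ^ Suc j) x" "3 * real j + 4" "partial (4 ^ j) x" p]
          abs_partial_power4_le[of "Suc j" x] abs_partial_power4_le[of j x] by simp
    qed
    also have "\<dots> = integral\<^sup>L unit_interval (\<lambda>x. partial (4 ^ j) x ^ p)
        + real p * (3 * real j + 4) ^ p * integral\<^sup>L unit_interval ?D"
      using int_D int by (subst Bochner_Integration.integral_add) auto
    also have "\<dots> \<le> integral\<^sup>L unit_interval (\<lambda>x. partial (4 ^ j) x ^ p)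
        + real p * (3 * real j + 4) ^ p * (7 * (1 / 2) ^ j)"
      by (intro add_left_mono mult_left_mono D_le) auto
    finally show ?thesis by (simp add: b_def mult_ac)
  qed
  have "integral\<^sup>L unit_interval (\<lambda>x. partial (4 ^ n) x ^ p)
      \<le> integral\<^sup>L unit_interval (\<lambda>x. partial 1 x ^ p) + sum b {..<n}" for n
  proof (induction n)
    case (Suc n)
    then show ?case using step[of n] by simp
  qed simp
  moreover have "sum b {..<n} \<le> suminf b" for n
    by (rule sum_le_suminf[OF b]) (auto intro: b_nonneg)
  ultimately show "integral\<^sup>L unit_interval (\<lambda>x. partial (4 ^ n) x ^ p)
     \<le> integral\<^sup>L unit_interval (\<lambda>x. partial 1 x ^ p) + suminf b" for n
    by (meson add_left_mono order.trans)
qed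

section \<open>Lower bound for the moments\<close>

text \<open>For such \<open>x\<close> all multiples up to \<open>n * x\<close> lie below 1, so no
  fractional part wraps around and the sum is \<open>harm n - 2 * n * x\<close>.\<close>

lemma partial_ge_ln:
  assumes "n > 0" "0 \<le> x" "x < 1 / real n"
  shows "ln (real n) - 2 \<le> partial n x"
proof -
  have nx: "real n * x < 1" using assms by (simp add: field_simps)
  have "g_term x l = inverse (real (Suc l)) - 2 * x" if "l < n" for l
  proof -
    have "real (Suc l) * x \<le> real n * x" using that assms by (intro mult_right_mono) auto
    then have "frac (real (Suc l) * x) = real (Suc l) * x" using nx assms by (subst frac_eq) simp
    then show ?thesis by (simp add: g_term_def diff_divide_distrib inverse_eq_divide del: of_nat_Suc)
  qed
  then have "partial n x = harm n - 2 * (real n * x)"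
    by (simp add: partial_def sum_subtractf harm_def sum.atLeast1_atMost_eq del: of_nat_Suc)
  moreover have "ln (real n) \<le> harm n"
    using harm_ge_ln[of n] assms(1) by (smt (verit) ln_mono of_nat_0_less_iff)
  ultimately show ?thesis using nx by linarith
qed

text \<open>The graph lies above its tangent at \<open>c\<close>; for even \<open>p\<close> this
  holds at negative \<open>y\<close> too. It is Bernoulli's inequality at \<open>(y - c) / c\<close>
  and takes the place of Jensen's inequality.\<close>

lemma power_tangent_le:
  fixes y c :: real
  assumes "even p" "c > 0"
  shows "c ^ p + real p * c ^ p / c * (y - c) \<le> y ^ p"
proof -
  have "c ^ p * (1 + real p * ((y - c) / c)) \<le> c ^ p * (1 + (y - c) / c) ^ p"
    using assms by (intro mult_left_mono Bernoulli_inequality_even) auto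
  also have "\<dots> = (c * (1 + (y - c) / c)) ^ p" by (rule power_mult_distrib[symmetric])
  also have "c * (1 + (y - c) / c) = y" using assms(2) by (simp add: field_simps)
  finally show ?thesis using assms(2) by (simp add: algebra_simps)
qed

text \<open>The 9 exceeds \<open>2 + 1 / 2 + 12 / 2\<close>: the 2 comes from \<open>partial_ge_ln\<close>, the rest from the bound
  \<open>1 / 2 + d\<^sup>2 / 2\<close> for \<open>\<bar>d\<bar>\<close> with \<open>d = g x - partial n x\<close>, whose square integrates to at most
  \<open>12 / n\<close>, comparable to the length \<open>1 / n\<close> of the interval.\<close>

lemma moment_ge:
  assumes p: "even p" and "c > 0" "n > 0" and ln: "c + 9 \<le> ln (real n)"
  shows "c ^ p / real n \<le> integral\<^sup>L unit_interval (\<lambda>x. g x ^ p)"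
proof -
  \<comment> \<open>The slope of the tangent to the \<open>p\<close>-th power at
    \<open>c\<close>.\<close>
  define w where "w = real p * c ^ p / c"
  define J where "J = {0..<1 / real n}"
  have w: "0 \<le> w" using assms by (simp add: w_def)
  define A where "A = c ^ p + w * (ln (real n) - 5 / 2 - c)"
  have int_J: "integrable unit_interval (\<lambda>x. indicator J x * A)"
    by (rule integrable_bounded_unit_interval[where B="\<bar>A\<bar>"]) (auto simp: J_def indicator_def)
  have J_integral: "integral\<^sup>L unit_interval (\<lambda>x. indicator J x * A) = A / real n"
  proof -
    have "1 / real n \<le> 1" using assms(3) by simp
    then have "indicator {0..<1} x * (indicator J x * A) = A * indicator J x" for x :: real
      unfolding J_def indicator_def by (smt (verit) atLeastLessThan_iff mult.commute mult_cancel_right1 mult_zero_left of_bool_eq)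
    then show ?thesis unfolding integral_unit_interval by (simp only:) (simp add: J_def)
  qed
  have "c ^ p / real n \<le> A / real n - w / 2 * (12 / real n)"
  proof -
    have "0 \<le> w * (ln (real n) - 5 / 2 - c - 6)" using w ln by simp
    then have "c ^ p \<le> A - w / 2 * 12" by (simp add: A_def algebra_simps)
    then have "c ^ p / real n \<le> (A - w / 2 * 12) / real n" by (rule divide_right_mono) simp
    then show ?thesis by (simp add: diff_divide_distrib)
  qed
  also have "\<dots> \<le> A / real n - w / 2 * integral\<^sup>L unit_interval (\<lambda>x. (g x - partial n x) ^ 2)"
    using assms(3) w by (intro diff_left_mono mult_left_mono g_minus_partial_square) auto
  also have "\<dots> = integral\<^sup>L unit_interval (\<lambda>x. indicator J x * A - w / 2 * (g x - partial n x) ^ 2)"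
    using int_J g_minus_partial_square(1)[of n] assms(3) J_integral
    by (subst Bochner_Integration.integral_diff) simp_all
  also have "\<dots> \<le> integral\<^sup>L unit_interval (\<lambda>x. g x ^ p)"
  proof (rule integral_mono[OF _ integrable_g_even_power[OF p]])
    show "integrable unit_interval (\<lambda>x. indicator J x * A - w / 2 * (g x - partial n x) ^ 2)"
      using int_J g_minus_partial_square(1)[of n] assms(3)
      by (intro Bochner_Integration.integrable_diff) auto
    \<comment> \<open>On \<open>J\<close> this is the tangent bound. Off \<open>J\<close> the left
      side is at most 0 and the even power is nonnegative, so the squared error may be kept on the
      whole interval, where its integral is controlled.\<close>
    show "indicator J x * A - w / 2 * (g x - partial n x) ^ 2 \<le> g x ^ p" for x
    proof (cases "x \<in> J")
      case True
      have "\<bar>d\<bar> \<le> 1 / 2 + d ^ 2 / 2" for d :: real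
        using zero_le_power2[of "\<bar>d\<bar> - 1"] by (simp add: power2_diff)
      then have "\<bar>g x - partial n x\<bar> \<le> 1 / 2 + (g x - partial n x) ^ 2 / 2" .
      moreover have "ln (real n) - 2 \<le> partial n x"
        using True assms(3) by (intro partial_ge_ln) (auto simp: J_def)
      ultimately have "ln (real n) - 5 / 2 - c - (g x - partial n x) ^ 2 / 2 \<le> g x - c"
        by linarith
      from mult_left_mono[OF this w]
      have "A - w / 2 * (g x - partial n x) ^ 2 \<le> c ^ p + w * (g x - c)"
        by (simp add: A_def algebra_simps)
      also have "\<dots> \<le> g x ^ p" unfolding w_def by (rule power_tangent_le[OF p assms(2)])
      finally show ?thesis using True by simp
    next
      case False
      then show ?thesis using w zero_le_even_power[OF p, of "g x"] by (simp add: order_trans[of _ 0])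
    qed
  qed
  finally show ?thesis .
qed

text \<open>A weak form of Stirling's upper bound, with equality at \<open>n = 1\<close>. The
  induction step rests on \<open>(1 + 1 / n) ^ (n + 1)\<close> being at least
  \<open>exp 1\<close>.\<close>

lemma fact_le_power_exp:
  assumes "n \<ge> 1"
  shows "fact n \<le> exp 1 * real n * (real n / exp 1) ^ n"
  using assms
proof (induction n rule: dec_induct)
  case (step n)
  have n: "real n > 0" using step.hyps by simp
  have "1 \<le> real (Suc n) * ln (1 + 1 / real n)"
  proof -
    have "ln (real n / (real n + 1)) \<le> real n / (real n + 1) - 1"
      using n by (intro ln_le_minus_one) simp
    also have "\<dots> = - (1 / (real n + 1))" using n by (simp add: field_simps)
    finally have "1 / (real n + 1) \<le> ln ((real n + 1) / real n)"
      using n by (simp add: ln_div)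
    then show ?thesis using n by (simp add: field_simps)
  qed
  then have "exp 1 \<le> exp (real (Suc n) * ln (1 + 1 / real n))" by simp
  also have "\<dots> = (1 + 1 / real n) ^ Suc n"
  proof -
    have "exp (ln (1 + 1 / real n)) = 1 + 1 / real n" using n by (intro exp_ln) (simp add: add_pos_pos)
    then show ?thesis by (simp only: exp_of_nat_mult)
  qed
  finally have e: "exp 1 \<le> (1 + 1 / real n) ^ Suc n" .
  have "fact (Suc n) \<le> real (Suc n) * (exp 1 * real n * (real n / exp 1) ^ n)"
    using step.IH by (simp add: mult_left_mono del: of_nat_Suc)
  also have "\<dots> = exp 1 * real (Suc n) * (real n / exp 1) ^ Suc n * exp 1"
    using n by (simp add: field_simps)
  also have "\<dots> \<le> exp 1 * real (Suc n) * (real n / exp 1) ^ Suc n * (1 + 1 / real n) ^ Suc n"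
    using e by (intro mult_left_mono) auto
  also have "\<dots> = exp 1 * real (Suc n) * (real n / exp 1 * (1 + 1 / real n)) ^ Suc n"
    by (simp only: power_mult_distrib mult.assoc)
  also have "real n / exp 1 * (1 + 1 / real n) = real (Suc n) / exp 1"
    using n by (simp add: field_simps)
  finally show ?case .
qed simp

text \<open>The choice \<open>c = p\<close> maximises \<open>c ^ p * exp (- c)\<close>. The
  exponential factors then cancel against those of the factorial bound, and only a factor of order
  \<open>1 / p\<close> is lost.\<close>

lemma moment_over_fact_ge:
  assumes "even p" "p > 0"
  shows "exp (- 10) / (2 * real p) \<le> integral\<^sup>L unit_interval (\<lambda>x. g x ^ p) / fact p"
proof -
  define c where "c = real p"
  \<comment> \<open>The least integer with \<open>ln n\<close> at least \<open>c + 9\<close>;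
    rounding up at most doubles \<open>exp (c + 9)\<close>.\<close>
  define n where "n = nat \<lceil>exp (c + 9)\<rceil>"
  have c: "c > 0" using assms by (simp add: c_def)
  have n_ge: "exp (c + 9) \<le> real n" by (simp add: n_def)
  have n: "n > 0" using n_ge by (metis exp_gt_zero less_le_trans of_nat_0_less_iff)
  have "real n \<le> exp (c + 9) + 1"
    using of_int_ceiling_le_add_one[of "exp (c + 9)"] by (simp add: n_def order.trans[of 0 1])
  also have "\<dots> \<le> 2 * exp (c + 9)" using c by simp
  finally have n_le: "real n \<le> 2 * exp (c + 9)" .
  have "c + 9 \<le> ln (real n)" using n_ge n by (simp add: ln_ge_iff)
  note moment = moment_ge[OF assms(1) c n this]
  have "exp (- 10) / (2 * c) = c ^ p / (2 * exp (c + 9)) / (exp 1 * c * (c / exp 1) ^ p)"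
  proof -
    have "exp 1 ^ p = exp c" by (simp add: c_def exp_of_nat_mult[symmetric])
    then show ?thesis using c
      by (simp add: power_divide exp_minus exp_add[symmetric] field_simps)
  qed
  also have "\<dots> \<le> c ^ p / real n / fact p"
  proof (rule frac_le)
    show "c ^ p / (2 * exp (c + 9)) \<le> c ^ p / real n"
      using n_le n c by (intro divide_left_mono) auto
    show "fact p \<le> exp 1 * c * (c / exp 1) ^ p"
      using fact_le_power_exp[of p] assms by (simp add: c_def)
  qed (use c in auto)
  also have "\<dots> \<le> integral\<^sup>L unit_interval (\<lambda>x. g x ^ p) / fact p"
    using moment by (rule divide_right_mono) simp
  finally show ?thesis by (simp add: c_def)
qed

section \<open>Divergence of the power series\<close>

lemma H_eq: "H k = integral\<^sup>L unit_interval (\<lambda>x. g x ^ (2 * k)) / pi ^ (2 * k)"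
proof -
  have "H k = (\<integral>x. indicator {0..1} x * (g x / pi) ^ (2 * k) \<partial>lborel)"
    unfolding H_def set_lebesgue_integral_def by (subst integral_completion) auto
  \<comment> \<open>The endpoint 1 is a null set.\<close>
  also have "\<dots> = (\<integral>x. indicator {0..<1} x * (g x / pi) ^ (2 * k) \<partial>lborel)"
    using AE_lborel_singleton[of "1::real"]
    by (intro integral_cong_AE) (auto elim!: eventually_mono simp: indicator_def)
  also have "\<dots> = integral\<^sup>L unit_interval (\<lambda>x. (g x / pi) ^ (2 * k))"
    by (rule integral_unit_interval[symmetric])
  finally show ?thesis by (simp add: power_divide)
qed

theorem theorem1p2:
  fixes x :: complex
  assumes "norm x > pi\<^sup>2"
  shows "\<not> summable (\<lambda>k. complex_of_real (H k / fact (2 * k)) * x ^ k)"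
proof
  assume "summable (\<lambda>k. complex_of_real (H k / fact (2 * k)) * x ^ k)"
  then have "(\<lambda>k. norm (complex_of_real (H k / fact (2 * k)) * x ^ k)) \<longlonglongrightarrow> 0"
    by (intro tendsto_norm_zero summable_LIMSEQ_zero)
  moreover define q where "q = norm x / pi\<^sup>2"
  have q: "q > 1" using assms by (simp add: q_def)
  \<comment> \<open>Multiplying the terms by this null sequence removes their growth
    \<open>q ^ k\<close> and compensates the factor \<open>1 / k\<close> in the moment bound. The
    product would tend to 0, yet it stays above a positive constant.\<close>
  then have "(\<lambda>k. real k * (1 / q) ^ k) \<longlonglongrightarrow> 0"
    by (intro powser_times_n_limit_0) simp
  ultimately have "(\<lambda>k. norm (complex_of_real (H k / fact (2 * k)) * x ^ k) * (real k * (1 / q) ^ k)) \<longlonglongrightarrow> 0"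
    by (rule tendsto_mult_zero)
  moreover have "exp (- 10) / 4 \<le> norm (complex_of_real (H k / fact (2 * k)) * x ^ k) * (real k * (1 / q) ^ k)"
    if "k \<ge> 1" for k
  proof -
    define m where "m = integral\<^sup>L unit_interval (\<lambda>x. g x ^ (2 * k)) / fact (2 * k)"
    have m: "exp (- 10) / (4 * real k) \<le> m"
      using moment_over_fact_ge[of "2 * k"] that by (simp add: m_def)
    then have "0 \<le> m" by (rule order_trans[rotated]) simp
    have "H k / fact (2 * k) = m / (pi\<^sup>2) ^ k" by (simp add: H_eq m_def power_mult)
    then have "norm (complex_of_real (H k / fact (2 * k)) * x ^ k) = m * q ^ k"
      using \<open>0 \<le> m\<close> by (simp add: norm_mult norm_power q_def power_divide norm_divide)
    then have "norm (complex_of_real (H k / fact (2 * k)) * x ^ k) * (real k * (1 / q) ^ k) = m * real k"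
      using q by (simp add: power_divide)
    moreover have "exp (- 10) / 4 \<le> m * real k"
      using m that by (simp add: field_simps)
    ultimately show ?thesis by (simp only:)
  qed
  ultimately have "exp (- 10) / 4 \<le> (0::real)"
    by (intro LIMSEQ_le_const) auto
  then show False by simp
qed

end
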